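(* Let $N$ be a positive integer, let $B$ be the $N\times N$ real upper bidiagonal matrix with diagonal entries $\sqrt{q_1},\dots,\sqrt{q_N}$ and upper subdiagonal entries $\sqrt{e_1},\dots,\sqrt{e_{N-1}}$, where all $q_i>0$ and $e_i>0$. Let $\check B_i=1/q_i$ for $i=1,\dots,N$ and $\tilde F_i=e_{i-1}/q_i$ for $i=2,\dots,N$. Let $\tilde g_i^{(1)}$ and $\tilde G_i^{(1)}$ for $i=1,\dots,N$ be quantities which satisfy the recurrence relation $$\tilde g_1^{(1)}=0,\qquad \tilde G_1^{(1)}=\check B_1,$$ $$\tilde g_i^{(1)}=\tilde F_i\,\tilde G_{i-1}^{(1)},\qquad \tilde G_i^{(1)}=\tilde g_i^{(1)}+\check B_i,\qquad i=2,\dots,N.$$ Let $\tilde g_i^{(M)}$ for $i=1,\dots,N$ and $M=2,3,\dots$ be quantities which satisfy the recurrence relation $$\tilde g_1^{(M)}=0,$$ $$\tilde g_i^{(M)}=\tilde F_i\,\tilde g_{i-1}^{(M)}+\tilde G_{i-1}^{(1)}\,\tilde g_i^{(M-1)}+\sum_{k=2}^{M-1}\tilde g_{i-1}^{(k)}\,\tilde g_i^{(M-k)},\qquad i=2,\dots,N.$$ Let $\tilde G_i^{(M)}$ for $i=1,\dots,N$ and $M=2,3,\dots$ be quantities which satisfy the recurrence relation $$\tilde G_i^{(M)}=M\,\tilde g_i^{(M)}+\tilde G_i^{(1)}\,\tilde G_i^{(M-1)}+\sum_{k=2}^{M-1}\tilde g_i^{(k)}\,\tilde G_i^{(M-k)}.$$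 Then, for an arbitrary positive integer $M$, the trace $J_M(B)$ is given by $$J_M(B)=\sum_{i=1}^{N}\tilde G_i^{(M)}.$$
   Context: The matrix $B$ has $(i,i)$-entry $\sqrt{q_i}$ ($i=1,\dots,N$), $(i,i+1)$-entry $\sqrt{e_i}$ ($i=1,\dots,N-1$), and all other entries zero. For a positive integer $M$, $J_M(B)=\mathrm{Tr}\left((B^{\top}B)^{-M}\right)=\mathrm{Tr}\left((BB^{\top})^{-M}\right)$. Convention: $\sum_{i=j}^{k}=0$ if $j>k$. *)

theory Defs
  imports Complex_Main "Jordan_Normal_Form.Determinant" "Jordan_Normal_Form.Gauss_Jordan_Elimination"
begin

definition mat_trace :: "'a :: comm_monoid_add mat \<Rightarrow> 'a" where
  "mat_trace A = (\<Sum>i<dim_row A. A $$ (i, i))"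

text \<open>The matrix inverse is only meaningful for an invertible argument; the library function
  \<open>mat_inverse\<close> returns \<open>None\<close> on singular matrices.\<close>

definition mat_inv :: "'a :: field mat \<Rightarrow> 'a mat" where
  "mat_inv A = the (mat_inverse A)"

text \<open>The sequences \<open>q\<close> and \<open>e\<close> are indexed from 1, whereas matrix entries are indexed from 0.\<close>

definition upper_bidiag :: "nat \<Rightarrow> (nat \<Rightarrow> real) \<Rightarrow> (nat \<Rightarrow> real) \<Rightarrow> real mat" where
  "upper_bidiag N q e = mat N N (\<lambda>(i, j).
     if j = i then sqrt (q (i + 1))
     else if j = i + 1 then sqrt (e (i + 1))
     else 0)"

definition J :: "nat \<Rightarrow> real mat \<Rightarrow> real" where
  "J M B = mat_trace (mat_inv (transpose_mat B * B) ^\<^sub>m M)"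

lemma mat_inv_eqI:
  fixes A :: "'a :: field mat"
  assumes A: "A \<in> carrier_mat n n" and C: "C \<in> carrier_mat n n" and AC: "A * C = 1\<^sub>m n"
  shows "mat_inv A = C"
proof -
  have CA: "C * A = 1\<^sub>m n" using mat_mult_left_right_inverse[OF A C AC] .
  have "A \<in> Units (ring_mat TYPE('a) n ())"
    using A C AC CA unfolding Units_def ring_mat_def by auto
  then obtain D where D: "mat_inverse A = Some D"
    using mat_inverse(1)[OF A, of "()"] by (cases "mat_inverse A") auto
  from mat_inverse(2)[OF A D] have D': "D * A = 1\<^sub>m n" "D \<in> carrier_mat n n" by auto
  have "D = D * (A * C)" using AC D' by simp
  also have "\<dots> = D * A * C" using assoc_mult_mat[OF D'(2) A C] by simp
  also have "\<dots> = C" using D' C by simp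
  finally show ?thesis by (simp add: mat_inv_def D)
qed

lemma mat_trace_comm:
  fixes A :: "'a :: comm_semiring_0 mat"
  assumes A: "A \<in> carrier_mat n m" and C: "C \<in> carrier_mat m n"
  shows "mat_trace (A * C) = mat_trace (C * A)"
proof -
  have "mat_trace (A * C) = (\<Sum>i<n. \<Sum>k<m. A $$ (i, k) * C $$ (k, i))"
    using A C by (auto simp: mat_trace_def scalar_prod_def atLeast0LessThan)
  also have "\<dots> = (\<Sum>k<m. \<Sum>i<n. A $$ (i, k) * C $$ (k, i))" by (rule sum.swap)
  also have "\<dots> = mat_trace (C * A)"
    using A C by (auto simp: mat_trace_def scalar_prod_def atLeast0LessThan mult.commute)
  finally show ?thesis .
qed

lemma pow_mat_prod_shift:
  assumes A: "A \<in> carrier_mat n n" and C: "C \<in> carrier_mat n n"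
  shows "(A * C) ^\<^sub>m k * A = A * (C * A) ^\<^sub>m k"
proof (induction k)
  case 0
  show ?case using A C by simp
next
  case (Suc k)
  have P: "(A * C) ^\<^sub>m k \<in> carrier_mat n n" "(C * A) ^\<^sub>m k \<in> carrier_mat n n"
    using A C by auto
  have "(A * C) ^\<^sub>m Suc k * A = (A * C) ^\<^sub>m k * (A * C) * A" by simp
  also have "\<dots> = (A * C) ^\<^sub>m k * A * (C * A)"
    using A C P by (simp add: assoc_mult_mat[of _ n n _ n _ n])
  also have "\<dots> = A * (C * A) ^\<^sub>m Suc k"
    using A C P by (simp add: Suc.IH assoc_mult_mat[of _ n n _ n _ n])
  finally show ?case .
qed

lemma mat_trace_pow_comm:
  fixes A :: "'a :: comm_semiring_1 mat"
  assumes A: "A \<in> carrier_mat n n" and C: "C \<in> carrier_mat n n"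
  shows "mat_trace ((A * C) ^\<^sub>m M) = mat_trace ((C * A) ^\<^sub>m M)"
proof (cases M)
  case 0
  then show ?thesis using A C by simp
next
  case (Suc k)
  have P: "(A * C) ^\<^sub>m k \<in> carrier_mat n n" "(C * A) ^\<^sub>m k \<in> carrier_mat n n"
    using A C by auto
  have "(A * C) ^\<^sub>m M = A * (C * A) ^\<^sub>m k * C"
    using A C P by (simp add: Suc pow_mat_prod_shift[OF A C, symmetric] assoc_mult_mat[of _ n n _ n _ n])
  also have "\<dots> = A * ((C * A) ^\<^sub>m k * C)"
    using A C P by (simp add: assoc_mult_mat[of _ n n _ n _ n])
  finally have "mat_trace ((A * C) ^\<^sub>m M) = mat_trace ((C * A) ^\<^sub>m k * C * A)"
    using A C P by (metis mat_trace_comm mult_carrier_mat)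
  also have "(C * A) ^\<^sub>m k * C * A = (C * A) ^\<^sub>m M"
    using A C P by (simp add: Suc assoc_mult_mat[of _ n n _ n _ n])
  finally show ?thesis .
qed

lemma J_alt:
  assumes B: "B \<in> carrier_mat n n" and inv: "invertible_mat B"
  shows "J M B = mat_trace (mat_inv (B * transpose_mat B) ^\<^sub>m M)"
proof -
  from inv obtain C where BC: "B * C = 1\<^sub>m n" and CB: "C * B = 1\<^sub>m (dim_row C)"
    using B unfolding invertible_mat_def inverts_mat_def by auto
  have C: "C \<in> carrier_mat n n"
    using arg_cong[OF BC, of dim_col] arg_cong[OF CB, of dim_col] B by auto
  note T = transpose_carrier_mat[THEN iffD2, OF B] transpose_carrier_mat[THEN iffD2, OF C]
  have CB': "C * B = 1\<^sub>m n" using CB C by simp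
  have t: "transpose_mat B * transpose_mat C = 1\<^sub>m n" "transpose_mat C * transpose_mat B = 1\<^sub>m n"
    using transpose_mult[OF C B] transpose_mult[OF B C] CB' BC by (metis transpose_one)+
  have "mat_inv (transpose_mat B * B) = C * transpose_mat C"
  proof (rule mat_inv_eqI)
    have "transpose_mat B * B * (C * transpose_mat C) = transpose_mat B * (B * C * transpose_mat C)"
      using B C T by (simp add: assoc_mult_mat[of _ n n _ n _ n])
    then show "transpose_mat B * B * (C * transpose_mat C) = 1\<^sub>m n"
      using BC T t by simp
  qed (use B C in auto)
  moreover have "mat_inv (B * transpose_mat B) = transpose_mat C * C"
  proof (rule mat_inv_eqI)
    have "B * transpose_mat B * (transpose_mat C * C) = B * (transpose_mat B * transpose_mat C * C)"
      using B C T by (simp add: assoc_mult_mat[of _ n n _ n _ n])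
    then show "B * transpose_mat B * (transpose_mat C * C) = 1\<^sub>m n"
      using BC C t by simp
  qed (use B C in auto)
  ultimately show ?thesis
    unfolding J_def using mat_trace_pow_comm[OF C T(2)] by simp
qed

lemma invertible_upper_bidiag:
  assumes "\<And>i. i \<in> {1..N} \<Longrightarrow> q i > 0"
  shows "invertible_mat (upper_bidiag N q e)"
proof -
  have c: "upper_bidiag N q e \<in> carrier_mat N N" by (simp add: upper_bidiag_def)
  have "upper_triangular (upper_bidiag N q e)" by (auto simp: upper_bidiag_def)
  then have "det (upper_bidiag N q e) = prod_list (diag_mat (upper_bidiag N q e))"
    using det_upper_triangular c by blast
  also have "\<dots> \<noteq> 0"
  proof -
    have "q (i + 1) \<noteq> 0" if "i < N" for i using assms[of "i + 1"] that by auto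
    then show ?thesis by (auto simp: prod_list_zero_iff diag_mat_def upper_bidiag_def)
  qed
  finally have "det (upper_bidiag N q e) \<noteq> 0" .
  then have "upper_bidiag N q e \<in> Units (ring_mat TYPE(real) N ())"
    by (rule det_non_zero_imp_unit[OF c])
  then show ?thesis
    using c unfolding Units_def ring_mat_def invertible_mat_def inverts_mat_def by auto
qed

end

theory Submission
  imports Defs "HOL-Computational_Algebra.Formal_Power_Series"
begin

text \<open>Put \<open>T = B\<^sup>T B\<close> and work over formal power series in \<open>x\<close>. The numbers \<open>J M B\<close> are the coefficients of
  \<open>x Tr ((T - x)\<^sup>-\<^sup>1)\<close>. With \<open>H\<^sub>i = x / q\<^sub>i + \<Sum>\<^sub>m g\<^sub>i\<^sup>m x\<^sup>m\<close>, the recurrence for \<open>g\<close> says exactly that \<open>r\<^sub>i = q\<^sub>i (1 - H\<^sub>i)\<close>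
  are the pivots of the tridiagonal matrix \<open>T - x\<close>, and the recurrence for \<open>G\<close> says that
  \<open>\<Sum>\<^sub>m G\<^sub>i\<^sup>m x\<^sup>m = - x r\<^sub>i' / r\<^sub>i\<close>. The theorem is then the logarithmic derivative of \<open>det (T - x) = r\<^sub>1 \<dots> r\<^sub>N\<close>,
  which for a tridiagonal matrix can be obtained by a telescoping sum, without determinants.\<close>

section \<open>Trace of the inverse of a symmetric tridiagonal matrix\<close>

text \<open>\<open>r\<close> are the pivots, \<open>s\<close> their inverses, and \<open>r'\<close> their derivatives when each \<open>d i\<close> has derivative \<open>- 1\<close>
  and each \<open>b i\<close> is constant.\<close>

lemma trace_inverse_tridiagonal:
  fixes R :: "nat \<Rightarrow> nat \<Rightarrow> 'a :: comm_ring_1" and d b r r' s :: "nat \<Rightarrow> 'a"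
  assumes row: "\<And>i j. 1 \<le> i \<Longrightarrow> i \<le> N \<Longrightarrow> 1 \<le> j \<Longrightarrow> j \<le> N \<Longrightarrow>
      b (i - 1) * R (i - 1) j + d i * R i j + b i * R (Suc i) j = (if i = j then 1 else 0)"
    and sym: "\<And>i j. R i j = R j i"
    and bdry: "\<And>j. R 0 j = 0" "\<And>j. R (Suc N) j = 0"
    and r1: "r 1 = d 1" and r_Suc: "\<And>i. 1 \<le> i \<Longrightarrow> i < N \<Longrightarrow> r (Suc i) = d (Suc i) - b i ^ 2 * s i"
    and rs: "\<And>i. 1 \<le> i \<Longrightarrow> i \<le> N \<Longrightarrow> r i * s i = 1"
    and r'1: "r' 1 = - 1" and r'_Suc: "\<And>i. 1 \<le> i \<Longrightarrow> i < N \<Longrightarrow> r' (Suc i) = - 1 + b i ^ 2 * s i ^ 2 * r' i"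
  shows "(\<Sum>i=1..N. R i i) = - (\<Sum>i=1..N. s i * r' i)"
proof (cases "N = 0")
  case False
  \<comment> \<open>If \<open>L D L\<^sup>T\<close> is the factorization with pivots \<open>r\<close>, then \<open>w = D L\<^sup>T R = L\<^sup>-\<^sup>1\<close> is unit lower triangular.\<close>
  define w where "w i j = r i * R i j + b i * R (Suc i) j" for i j
  \<comment> \<open>Row \<open>Suc i\<close> of the linear system, with \<open>d (Suc i)\<close>
    replaced through \<open>r_Suc\<close>, is one step of forward substitution.\<close>
  have w_row: "w (Suc i) j = (if Suc i = j then 1 else 0) - b i * s i * w i j"
    if "1 \<le> i" "i < N" "1 \<le> j" "j \<le> N" for i j
  proof -
    have "b i * s i * w i j = b i * (r i * s i) * R i j + b i ^ 2 * s i * R (Suc i) j"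
      by (simp add: w_def algebra_simps power2_eq_square)
    also have "\<dots> = b i * R i j + b i ^ 2 * s i * R (Suc i) j"
      using rs that by simp
    finally show ?thesis
      using row[of "Suc i" j] that by (simp add: w_def r_Suc algebra_simps)
  qed
  have w_first: "w 1 j = (if 1 = j then 1 else 0)" if "1 \<le> j" "j \<le> N" for j
    using row[of 1 j] that bdry False by (simp add: w_def r1[simplified])
  have w_upper: "w i j = 0" if "1 \<le> i" "i < j" "j \<le> N" for i j
    using that
  proof (induction i rule: nat_induct_at_least)
    case base
    then show ?case using w_first[of j] by simp
  next
    case (Suc i)
    then show ?case using w_row[of i j] by simp
  qed
  have w_diag: "w i i = 1" if "1 \<le> i" "i \<le> N" for i
  proof (cases "i = 1")
    case True
    then show ?thesis using w_first[of 1] False by simp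
  next
    case i: False
    then show ?thesis
      using w_row[of "i - 1" i] w_upper[of "i - 1" i] that by simp
  qed
  \<comment> \<open>Row \<open>i\<close> of \<open>w\<close> is 1 on the diagonal and 0 just right
    of it; with the symmetry of \<open>R\<close>, these two equations eliminate
    \<open>R (Suc i) i\<close>.\<close>
  have R_diag: "R i i = s i + b i ^ 2 * s i ^ 2 * R (Suc i) (Suc i)" if i: "1 \<le> i" "i < N" for i
  proof -
    have sr: "s i * r i = 1" using rs[OF i(1)] i by (simp add: mult.commute)
    have 1: "r i * R i i + b i * R (Suc i) i = 1"
      using w_diag[of i] i by (simp add: w_def)
    have 2: "r i * R (Suc i) i + b i * R (Suc i) (Suc i) = 0"
      using w_upper[of i "Suc i"] i sym[of i "Suc i"] by (simp add: w_def)
    have "R i i = s i * (r i * R i i)" using sr by (simp flip: mult.assoc)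
    also have "\<dots> = s i * (1 - b i * R (Suc i) i)"
      unfolding 1[symmetric] by simp
    also have "R (Suc i) i = s i * (r i * R (Suc i) i)"
      using sr by (simp flip: mult.assoc)
    also have "r i * R (Suc i) i = - (b i * R (Suc i) (Suc i))"
      using 2 by (simp add: eq_neg_iff_add_eq_0)
    finally show ?thesis by (simp add: algebra_simps power2_eq_square)
  qed
  \<comment> \<open>By \<open>R_diag\<close> and \<open>r'_Suc\<close>,
    \<open>t (Suc i) = (R i i - s i) * r' i\<close>, which makes \<open>t i - t (Suc i)\<close> the
    summand.\<close>
  define t where "t i = R i i * (1 + r' i)" for i
  have step: "R i i + s i * r' i = t i - t (Suc i)" if i: "1 \<le> i" "i < N" for i
  proof -
    have "t (Suc i) = (b i ^ 2 * s i ^ 2 * R (Suc i) (Suc i)) * r' i"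
      using i by (simp add: t_def r'_Suc)
    also have "b i ^ 2 * s i ^ 2 * R (Suc i) (Suc i) = R i i - s i"
      using R_diag[OF i] by simp
    finally show ?thesis by (simp add: t_def algebra_simps)
  qed
  have telescope: "(\<Sum>i=1..<k. R i i + s i * r' i) = t 1 - t k" if "1 \<le> k" "k \<le> N" for k
    using that
  proof (induction k rule: nat_induct_at_least)
    case (Suc k)
    then show ?case using step[of k] by simp
  qed simp
  \<comment> \<open>The row below the last vanishes, so \<open>R N N = s N\<close> and the last
    summand is \<open>t N\<close> itself; as \<open>t 1 = 0\<close>, everything cancels.\<close>
  have "r N * R N N = 1"
    using w_diag[of N] bdry False by (simp add: w_def)
  moreover have "r N * s N = 1" using rs[of N] False by simp
  ultimately have "R N N = s N" by (metis mult.assoc mult.commute mult.right_neutral)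
  then have "R N N + s N * r' N = t N"
    by (simp add: t_def algebra_simps)
  moreover have "t 1 = 0" using r'1 by (simp add: t_def)
  moreover have "{1..N} = insert N {1..<N}" using False by auto
  ultimately have "(\<Sum>i=1..N. R i i + s i * r' i) = 0"
    using telescope[of N] False by simp
  then show ?thesis by (simp add: sum.distrib eq_neg_iff_add_eq_0)
qed simp

section \<open>Inverse of a Gram matrix and its powers\<close>

lemma inverse_gram:
  fixes B :: "'a :: field mat"
  assumes B: "B \<in> carrier_mat n n" and inv: "invertible_mat B"
  obtains S where "S \<in> carrier_mat n n" "mat_inv (transpose_mat B * B) = S"
    "transpose_mat B * B * S = 1\<^sub>m n" "transpose_mat S = S"
proof -
  from inv obtain C where BC: "B * C = 1\<^sub>m n" and CB: "C * B = 1\<^sub>m (dim_row C)"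
    using B unfolding invertible_mat_def inverts_mat_def by auto
  have C: "C \<in> carrier_mat n n"
    using arg_cong[OF BC, of dim_col] arg_cong[OF CB, of dim_col] B by auto
  note T = transpose_carrier_mat[THEN iffD2, OF B] transpose_carrier_mat[THEN iffD2, OF C]
  \<comment> \<open>The witness is \<open>C * transpose_mat C\<close> with \<open>C\<close> the
    inverse of \<open>B\<close>, a form that makes the symmetry evident.\<close>
  have "transpose_mat B * B * (C * transpose_mat C) = transpose_mat B * (B * C * transpose_mat C)"
    using B C T by (simp add: assoc_mult_mat[of _ n n _ n _ n])
  also have "\<dots> = transpose_mat (C * B)"
    using BC B C T by (simp add: transpose_mult[OF C B])
  finally have "transpose_mat B * B * (C * transpose_mat C) = 1\<^sub>m n"
    using CB C by simp
  moreover have "transpose_mat (C * transpose_mat C) = C * transpose_mat C"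
    using transpose_mult[OF C T(2)] by simp
  ultimately show thesis
    using that[of "C * transpose_mat C"] mat_inv_eqI[of "transpose_mat B * B" n "C * transpose_mat C"] B C T
    by simp
qed

text \<open>Powers unfold with the new factor on the right; the left form is needed after
  transposition has reversed the factors, and to cancel the leftmost factor against an
  inverse.\<close>

lemma pow_mat_Suc_left:
  assumes "A \<in> carrier_mat n n"
  shows "A ^\<^sub>m Suc k = A * A ^\<^sub>m k"
proof (induction k)
  case 0
  then show ?case using assms by simp
next
  case (Suc k)
  have "A ^\<^sub>m Suc (Suc k) = A * A ^\<^sub>m k * A" using Suc by simp
  then show ?case using assms by (simp add: assoc_mult_mat[of _ n n _ n _ n])
qed

lemma transpose_pow_mat:
  fixes A :: "'a :: comm_semiring_1 mat"
  assumes A: "A \<in> carrier_mat n n"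
  shows "transpose_mat (A ^\<^sub>m k) = transpose_mat A ^\<^sub>m k"
proof (induction k)
  case (Suc k)
  then show ?case
    using pow_mat_Suc_left[of "transpose_mat A" n k] transpose_mult[of "A ^\<^sub>m k" n n A n] A
    by simp
qed (use A in simp)

lemma mat_mult_pow_inverse:
  fixes T S :: "'a :: semiring_1 mat"
  assumes "T \<in> carrier_mat n n" "S \<in> carrier_mat n n" "T * S = 1\<^sub>m n"
  shows "T * S ^\<^sub>m Suc k = S ^\<^sub>m k"
  using assms assoc_mult_mat[of T n n S n "S ^\<^sub>m k" n]
  by (simp del: pow_mat.simps(2) add: pow_mat_Suc_left)

section \<open>The tridiagonal matrix \<open>B^T B\<close>\<close>

lemma upper_bidiag_carrier: "upper_bidiag N q e \<in> carrier_mat N N"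
  by (simp add: upper_bidiag_def)

lemma upper_bidiag_mult_index:
  assumes V: "V \<in> carrier_mat N N" and ij: "i < N" "j < N"
  shows "(upper_bidiag N q e * V) $$ (i, j) =
    sqrt (q (i + 1)) * V $$ (i, j) + (if i + 1 < N then sqrt (e (i + 1)) * V $$ (i + 1, j) else 0)"
proof -
  \<comment> \<open>Row \<open>i\<close> meets only columns \<open>i\<close> and
    \<open>i + 1\<close>; the second indicator falls outside the range of summation in the last
    row.\<close>
  have "(upper_bidiag N q e * V) $$ (i, j) =
    (\<Sum>l<N. (if l = i then sqrt (q (i + 1)) * V $$ (i, j) else 0)
       + (if l = i + 1 then sqrt (e (i + 1)) * V $$ (i + 1, j) else 0))"
    using assms by (auto simp: scalar_prod_def atLeast0LessThan upper_bidiag_def intro!: sum.cong)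
  then show ?thesis using ij by (simp add: sum.distrib)
qed

lemma transpose_upper_bidiag_mult_index:
  assumes V: "V \<in> carrier_mat N N" and ij: "i < N" "j < N"
  shows "(transpose_mat (upper_bidiag N q e) * V) $$ (i, j) =
    sqrt (q (i + 1)) * V $$ (i, j) + (if 0 < i then sqrt (e i) * V $$ (i - 1, j) else 0)"
proof (cases i)
  case 0
  then show ?thesis
    using assms by (simp add: scalar_prod_def atLeast0LessThan upper_bidiag_def mult_delta_left cong: if_cong)
next
  case (Suc k)
  have "(transpose_mat (upper_bidiag N q e) * V) $$ (i, j) =
    (\<Sum>l<N. (if l = i then sqrt (q (i + 1)) * V $$ (i, j) else 0)
       + (if l = k then sqrt (e i) * V $$ (k, j) else 0))"
    using assms Suc by (auto simp: scalar_prod_def atLeast0LessThan upper_bidiag_def intro!: sum.cong)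
  then show ?thesis using ij Suc by (simp add: sum.distrib)
qed

text \<open>Counted from 1, \<open>B^T B\<close> has diagonal \<open>q i + e (i - 1)\<close> and
  off-diagonal \<open>sqrt (q i * e i)\<close>; rows are counted from 0 here, hence the shifted
  indices. Nonnegativity lets products of equal square roots collapse.\<close>

lemma gram_upper_bidiag_mult_index:
  fixes q e :: "nat \<Rightarrow> real"
  assumes q: "\<And>i. 1 \<le> i \<Longrightarrow> i \<le> N \<Longrightarrow> 0 \<le> q i" and e: "\<And>i. 1 \<le> i \<Longrightarrow> i < N \<Longrightarrow> 0 \<le> e i"
    and V: "V \<in> carrier_mat N N" and ij: "i < N" "j < N"
  shows "(transpose_mat (upper_bidiag N q e) * upper_bidiag N q e * V) $$ (i, j) =
    (if 0 < i then sqrt (q i * e i) * V $$ (i - 1, j) else 0)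
    + (q (i + 1) + (if 0 < i then e i else 0)) * V $$ (i, j)
    + (if i + 1 < N then sqrt (q (i + 1) * e (i + 1)) * V $$ (i + 1, j) else 0)"
proof -
  let ?B = "upper_bidiag N q e"
  note B = upper_bidiag_carrier[of N q e]
  have BV: "?B * V \<in> carrier_mat N N" using B V by simp
  have gram: "transpose_mat ?B * ?B * V = transpose_mat ?B * (?B * V)"
    using B V by (simp add: assoc_mult_mat[of _ N N _ N _ N])
  have sqrt_q: "sqrt (q (Suc i)) * (sqrt (q (Suc i)) * x) = q (Suc i) * x" for x
    using q[of "Suc i"] ij by (simp flip: mult.assoc)
  have sqrt_e: "sqrt (e i) * (sqrt (e i) * x) = e i * x" if "0 < i" for x
    using e[of i] that ij by (simp flip: mult.assoc)
  show ?thesis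
  proof (cases "i = 0")
    case True
    then have "(transpose_mat ?B * (?B * V)) $$ (i, j) = sqrt (q (Suc i)) * (?B * V) $$ (i, j)"
      using transpose_upper_bidiag_mult_index[OF BV ij, of q e] by simp
    then show ?thesis
      unfolding gram upper_bidiag_mult_index[OF V ij]
      using True sqrt_q[simplified True] by (simp add: real_sqrt_mult distrib_left mult.assoc)
  next
    case False
    then have BV': "(?B * V) $$ (i - 1, j) = sqrt (q i) * V $$ (i - 1, j) + sqrt (e i) * V $$ (i, j)"
      using upper_bidiag_mult_index[OF V, of "i - 1" j q e] ij by simp
    have "(transpose_mat ?B * (?B * V)) $$ (i, j) =
      sqrt (q (Suc i)) * (?B * V) $$ (i, j) + sqrt (e i) * (?B * V) $$ (i - 1, j)"
      using False by (simp add: transpose_upper_bidiag_mult_index[OF BV ij])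
    then show ?thesis
      unfolding gram BV' upper_bidiag_mult_index[OF V ij]
      using False sqrt_q sqrt_e by (simp add: real_sqrt_mult distrib_left distrib_right mult.assoc mult.left_commute)
  qed
qed

section \<open>The resolvent as a matrix of power series\<close>

text \<open>Entries, indexed from 1 and extended by 0, of the expansion of \<open>(S\<^sup>-\<^sup>1 - x)\<^sup>-\<^sup>1\<close> in powers of \<open>x\<close>.\<close>

definition resolvent_fps :: "nat \<Rightarrow> real mat \<Rightarrow> nat \<Rightarrow> nat \<Rightarrow> real fps" where
  "resolvent_fps N S i j = (if i \<in> {1..N} \<and> j \<in> {1..N}
     then Abs_fps (\<lambda>k. (S ^\<^sub>m Suc k) $$ (i - 1, j - 1)) else 0)"

lemma resolvent_fps_sym:
  assumes S: "S \<in> carrier_mat N N" "transpose_mat S = S"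
  shows "resolvent_fps N S i j = resolvent_fps N S j i"
proof (cases "i \<in> {1..N} \<and> j \<in> {1..N}")
  case True
  have "(S ^\<^sub>m k) $$ (i - 1, j - 1) = (S ^\<^sub>m k) $$ (j - 1, i - 1)" for k
  proof -
    have "S ^\<^sub>m k \<in> carrier_mat N N" using S(1) by (rule pow_carrier_mat)
    then have "transpose_mat (S ^\<^sub>m k) $$ (i - 1, j - 1) = (S ^\<^sub>m k) $$ (j - 1, i - 1)"
      using True by (intro index_transpose_mat(1)) auto
    then show ?thesis using S transpose_pow_mat[OF S(1), of k] by simp
  qed
  then show ?thesis using True by (simp add: resolvent_fps_def del: pow_mat.simps(2))
qed (auto simp: resolvent_fps_def)

text \<open>With \<open>T = B^T B\<close>, the identity \<open>T * S^(k+1) = S^k\<close> makes all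
  coefficients of \<open>(T - x) * \<Sum> S^(k+1) x^k\<close> cancel except the identity matrix at
  \<open>k = 0\<close>. Out-of-range values such as \<open>e 0\<close> and \<open>e N\<close> are
  multiplied by entries of \<open>resolvent_fps\<close> that are 0.\<close>

lemma resolvent_fps_row:
  assumes q: "\<And>i. 1 \<le> i \<Longrightarrow> i \<le> N \<Longrightarrow> 0 \<le> q i" and e: "\<And>i. 1 \<le> i \<Longrightarrow> i < N \<Longrightarrow> 0 \<le> e i"
    and S: "S \<in> carrier_mat N N"
    and inv: "transpose_mat (upper_bidiag N q e) * upper_bidiag N q e * S = 1\<^sub>m N"
    and ij: "1 \<le> i" "i \<le> N" "1 \<le> j" "j \<le> N"
  shows "fps_const (sqrt (q (i - 1) * e (i - 1))) * resolvent_fps N S (i - 1) j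
    + (fps_const (q i + (if i = 1 then 0 else e (i - 1))) - fps_X) * resolvent_fps N S i j
    + fps_const (sqrt (q i * e i)) * resolvent_fps N S (Suc i) j = (if i = j then 1 else 0)"
proof (rule fps_ext)
  fix k
  let ?T = "transpose_mat (upper_bidiag N q e) * upper_bidiag N q e"
  let ?V = "S ^\<^sub>m Suc k"
  have T: "?T \<in> carrier_mat N N" using upper_bidiag_carrier[of N q e] by simp
  have V: "?V \<in> carrier_mat N N" using S by (rule pow_carrier_mat)
  have "(S ^\<^sub>m k) $$ (i - 1, j - 1) = (?T * ?V) $$ (i - 1, j - 1)"
    using mat_mult_pow_inverse[OF T S inv, of k] by simp
  also have "\<dots> = (if i = 1 then 0 else sqrt (q (i - 1) * e (i - 1)) * ?V $$ (i - 2, j - 1))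
    + (q i + (if i = 1 then 0 else e (i - 1))) * ?V $$ (i - 1, j - 1)
    + (if i < N then sqrt (q i * e i) * ?V $$ (i, j - 1) else 0)"
  proof -
    have lt: "i - 1 < N" "j - 1 < N" and "i - 1 + 1 = i" "0 < i - 1 \<longleftrightarrow> i \<noteq> 1" "i - 1 - 1 = i - 2"
      using ij by auto
    with gram_upper_bidiag_mult_index[of N q e, OF q e V lt] show ?thesis
      by (simp only: split: if_split) simp
  qed
  also have "\<dots> = sqrt (q (i - 1) * e (i - 1)) * fps_nth (resolvent_fps N S (i - 1) j) k
    + (q i + (if i = 1 then 0 else e (i - 1))) * fps_nth (resolvent_fps N S i j) k
    + sqrt (q i * e i) * fps_nth (resolvent_fps N S (Suc i) j) k"
  proof -
    have nth: "fps_nth (resolvent_fps N S l j) k = (if l \<in> {1..N} then ?V $$ (l - 1, j - 1) else 0)" for l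
      using ij by (simp add: resolvent_fps_def del: pow_mat.simps(2))
    have "i - 1 \<in> {1..N} \<longleftrightarrow> i \<noteq> 1" "Suc i \<in> {1..N} \<longleftrightarrow> i < N" "i \<in> {1..N}" "i - 1 - 1 = i - 2"
      using ij by auto
    then show ?thesis unfolding nth by (simp del: pow_mat.simps(2))
  qed
  finally have main: "(S ^\<^sub>m k) $$ (i - 1, j - 1) = \<dots>" .
  have pow: "(S ^\<^sub>m k) $$ (i - 1, j - 1) =
      (if k = 0 then if i = j then 1 else 0 else fps_nth (resolvent_fps N S i j) (k - 1))"
  proof (cases k)
    case 0
    then show ?thesis using ij S(1) by auto
  qed (use ij in \<open>simp add: resolvent_fps_def\<close>)
  have coeff: "fps_nth (fps_const (sqrt (q (i - 1) * e (i - 1))) * resolvent_fps N S (i - 1) j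
    + (fps_const (q i + (if i = 1 then 0 else e (i - 1))) - fps_X) * resolvent_fps N S i j
    + fps_const (sqrt (q i * e i)) * resolvent_fps N S (Suc i) j) k =
      sqrt (q (i - 1) * e (i - 1)) * fps_nth (resolvent_fps N S (i - 1) j) k
    + (q i + (if i = 1 then 0 else e (i - 1))) * fps_nth (resolvent_fps N S i j) k
    + sqrt (q i * e i) * fps_nth (resolvent_fps N S (Suc i) j) k
    - (if k = 0 then 0 else fps_nth (resolvent_fps N S i j) (k - 1))"
    by (simp add: left_diff_distrib del: fps_const_add)
  show "fps_nth (fps_const (sqrt (q (i - 1) * e (i - 1))) * resolvent_fps N S (i - 1) j
    + (fps_const (q i + (if i = 1 then 0 else e (i - 1))) - fps_X) * resolvent_fps N S i j
    + fps_const (sqrt (q i * e i)) * resolvent_fps N S (Suc i) j) k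
    = fps_nth (if i = j then 1 else 0) k"
    unfolding coeff main[symmetric] pow by simp
qed

section \<open>Generating functions of the recurrences\<close>

text \<open>Vanishing constant terms remove both ends of the Cauchy product. Splitting off
  \<open>k = 1\<close> gives the shape of the recurrences, where that factor is \<open>G 1 i\<close>
  instead of \<open>g 1 i\<close>.\<close>

lemma fps_mult_nth_ge_2:
  fixes A C :: "'a :: comm_semiring_1 fps"
  assumes "fps_nth A 0 = 0" "fps_nth C 0 = 0" "m \<ge> 2"
  shows "fps_nth (A * C) m = fps_nth A 1 * fps_nth C (m - 1)
    + (\<Sum>k=2..m-1. fps_nth A k * fps_nth C (m - k))"
proof -
  have "{0..m} = insert 0 (insert 1 (insert m {2..m-1}))" using assms(3) by auto
  then show ?thesis using assms by (simp add: fps_mult_nth)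
qed

theorem theorem15:
  fixes N M :: nat
    and q e Bc Ft :: "nat \<Rightarrow> real"
    and g G :: "nat \<Rightarrow> nat \<Rightarrow> real"
  assumes N_pos: "N \<ge> 1"
    and q_pos: "\<forall>i\<in>{1..N}. q i > 0"
    and e_pos: "\<forall>i\<in>{1..N-1}. e i > 0"
    and Bc: "\<forall>i\<in>{1..N}. Bc i = 1 / q i"
    and Ft: "\<forall>i\<in>{2..N}. Ft i = e (i - 1) / q i"
    and g1_init: "g 1 1 = 0"
    and G1_init: "G 1 1 = Bc 1"
    and g1_rec: "\<forall>i\<in>{2..N}. g 1 i = Ft i * G 1 (i - 1)"
    and G1_rec: "\<forall>i\<in>{2..N}. G 1 i = g 1 i + Bc i"
    and g_init: "\<forall>m\<ge>2. g m 1 = 0"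
    and g_rec: "\<forall>m\<ge>2. \<forall>i\<in>{2..N}. g m i =
      Ft i * g m (i - 1) + G 1 (i - 1) * g (m - 1) i
        + (\<Sum>k=2..m-1. g k (i - 1) * g (m - k) i)"
    and G_rec: "\<forall>m\<ge>2. \<forall>i\<in>{1..N}. G m i =
      real m * g m i + G 1 i * G (m - 1) i + (\<Sum>k=2..m-1. g k i * G (m - k) i)"
    and M_pos: "M \<ge> 1"
  shows "J M (upper_bidiag N q e) = (\<Sum>i=1..N. G M i)"
proof -
  from N_pos q_pos have q: "0 < q i" if "1 \<le> i" "i \<le> N" for i using that by simp
  have e: "0 < e i" if "1 \<le> i" "i < N" for i using e_pos that by simp
  let ?B = "upper_bidiag N q e"
  obtain S where S: "S \<in> carrier_mat N N" "mat_inv (transpose_mat ?B * ?B) = S"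
      "transpose_mat ?B * ?B * S = 1\<^sub>m N" "transpose_mat S = S"
    by (rule inverse_gram[OF upper_bidiag_carrier[of N q e] invertible_upper_bidiag]) (use q in auto)
  let ?R = "resolvent_fps N S"
  \<comment> \<open>For \<open>i\<close> in range, \<open>H i\<close> carries \<open>G 1 i\<close>
    at degree 1 and \<open>g m i\<close> from degree 2 on, the factors with which the recurrences
    convolve; its zero constant term makes \<open>1 - H i\<close> invertible.\<close>
  define H where "H i = Abs_fps (\<lambda>m. if m = 0 then 0 else g m i + (if m = 1 then Bc i else 0))" for i
  define gs where "gs i = Abs_fps (\<lambda>m. if m = 0 then 0 else g m i)" for i
  define Gs where "Gs i = Abs_fps (\<lambda>m. if m = 0 then 0 else G m i)" for i
  have H: "H i = gs i + fps_const (Bc i) * fps_X" for i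
    by (rule fps_ext) (simp add: H_def gs_def fps_X_def)
  have H_nth: "fps_nth (H i) 0 = 0" "fps_nth (gs i) 0 = 0" "fps_nth (Gs i) 0 = 0"
      "m \<ge> 2 \<Longrightarrow> fps_nth (H i) m = g m i" for i m
    by (auto simp: H_def gs_def Gs_def)
  have H_1: "fps_nth (H i) 1 = G 1 i" if "1 \<le> i" "i \<le> N" for i
    using that g1_init G1_init G1_rec[rule_format, of i] by (cases "i = 1") (simp_all add: H_def)
  have gs_first: "gs 1 = 0"
  proof (rule fps_ext)
    show "fps_nth (gs 1) m = fps_nth 0 m" for m
      using g1_init g_init by (cases "m = 1") (auto simp: gs_def)
  qed
  \<comment> \<open>The product of \<open>Ft\<close> and \<open>H\<close> yields
    \<open>Ft * G 1\<close> at degree 1 and \<open>Ft * g m\<close> above, so one identity covers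
    both recurrences for \<open>g\<close>.\<close>
  have gs_rec: "gs (Suc i) = fps_const (Ft (Suc i)) * H i + H i * gs (Suc i)"
    if i: "1 \<le> i" "i < N" for i
  proof (rule fps_ext)
    fix m :: nat
    consider "m = 0" | "m = 1" | "m \<ge> 2" by linarith
    then show "fps_nth (gs (Suc i)) m = fps_nth (fps_const (Ft (Suc i)) * H i + H i * gs (Suc i)) m"
    proof cases
      case 2
      then show ?thesis using i H_1[of i] g1_rec[rule_format, of "Suc i"] H_nth by (simp add: gs_def)
    next
      case 3
      have "(\<Sum>k=2..m-1. fps_nth (H i) k * fps_nth (gs (Suc i)) (m - k))
          = (\<Sum>k=2..m-1. g k i * g (m - k) (Suc i))"
        by (rule sum.cong) (auto simp: H_nth gs_def)
      with 3 show ?thesis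
        using i g_rec[rule_format, of m "Suc i"] H_1[of i] fps_mult_nth_ge_2[of "H i" "gs (Suc i)" m] H_nth
        by (simp add: gs_def)
    qed (simp add: H_nth)
  qed
  \<comment> \<open>The factor \<open>real m\<close> comes from \<open>fps_X * fps_deriv\<close>,
    which multiplies the coefficient of degree \<open>m\<close> by \<open>m\<close>.\<close>
  have Gs_rec: "Gs i = fps_X * fps_deriv (H i) + H i * Gs i" if i: "1 \<le> i" "i \<le> N" for i
  proof (rule fps_ext)
    fix m :: nat
    consider "m = 0" | "m = 1" | "m \<ge> 2" by linarith
    then show "fps_nth (Gs i) m = fps_nth (fps_X * fps_deriv (H i) + H i * Gs i) m"
    proof cases
      case 2
      then show ?thesis using i H_1[of i] H_nth by (simp add: Gs_def)
    next
      case 3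
      have "(\<Sum>k=2..m-1. fps_nth (H i) k * fps_nth (Gs i) (m - k))
          = (\<Sum>k=2..m-1. g k i * G (m - k) i)"
        by (rule sum.cong) (auto simp: H_nth Gs_def)
      with 3 show ?thesis
        using i G_rec[rule_format, of m i] H_1[of i] fps_mult_nth_ge_2[of "H i" "Gs i" m] H_nth by (simp add: Gs_def)
    qed (simp add: H_nth)
  qed

  \<comment> \<open>Pivots and their logarithmic derivatives\<close>
  define y where "y i = inverse (1 - H i)" for i
  have y: "y i * (1 - H i) = 1" for i
    unfolding y_def by (rule inverse_mult_eq_1) (simp add: H_nth)
  define r where "r i = fps_const (q i) * (1 - H i)" for i
  define s where "s i = fps_const (1 / q i) * y i" for i
  have const_q: "fps_const (q i) * fps_const (1 / q i) = 1" if "1 \<le> i" "i \<le> N" for i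
    using q[OF that] by simp
  have rs: "r i * s i = 1" if "1 \<le> i" "i \<le> N" for i
    using const_q[OF that] y[of i] unfolding r_def s_def by (metis mult.assoc mult.commute mult_1)
  \<comment> \<open>\<open>d\<close> and \<open>b\<close> are the diagonal and off-diagonal entries
    of \<open>B^T B - x\<close>; no \<open>e\<close> enters the first diagonal entry.\<close>
  define d where "d i = fps_const (q i + (if i = 1 then 0 else e (i - 1))) - fps_X" for i
  define b where "b i = fps_const (sqrt (q i * e i))" for i
  have b_sq: "b i ^ 2 = fps_const (q i * e i)" if "1 \<le> i" "i < N" for i
    using q[of i] e[of i] that by (simp add: b_def fps_const_power)
  have r_first: "r 1 = d 1"
    using const_q[of 1] Bc N_pos
    by (simp add: r_def d_def H gs_first[simplified] right_diff_distrib flip: mult.assoc)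
  \<comment> \<open>Solving \<open>gs_rec\<close> gives \<open>gs (Suc i)\<close> as
    \<open>Ft (Suc i)\<close> times \<open>y i - 1\<close>; the factor \<open>q (Suc i)\<close>
    turns \<open>Ft (Suc i)\<close> into \<open>e i\<close>, and \<open>e i * y i\<close> is
    \<open>b i ^ 2 * s i\<close> because \<open>q i\<close> cancels.\<close>
  have r_Suc: "r (Suc i) = d (Suc i) - b i ^ 2 * s i" if i: "1 \<le> i" "i < N" for i
  proof -
    have Hy: "H i * y i = y i - 1" using y[of i] by (simp add: algebra_simps)
    have "gs (Suc i) = gs (Suc i) * (1 - H i) * y i"
      using y[of i] by (simp add: mult.assoc mult.commute[of "1 - H i"])
    also have "gs (Suc i) * (1 - H i) = fps_const (Ft (Suc i)) * H i"
      using gs_rec[OF i] by (simp add: algebra_simps)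
    finally have gs_eq: "gs (Suc i) = fps_const (Ft (Suc i)) * (y i - 1)"
      by (simp add: mult.assoc Hy)
    have "fps_const (q (Suc i)) * fps_const (Ft (Suc i)) = fps_const (e i)"
      using Ft i q[of "Suc i"] by simp
    then have 1: "fps_const (q (Suc i)) * gs (Suc i) = fps_const (e i) * (y i - 1)"
      unfolding gs_eq by (simp flip: mult.assoc)
    have 2: "fps_const (q (Suc i)) * (fps_const (Bc (Suc i)) * fps_X) = fps_X"
      using Bc i const_q[of "Suc i"] by (simp flip: mult.assoc)
    have "r (Suc i) = fps_const (q (Suc i)) - fps_const (q (Suc i)) * gs (Suc i)
        - fps_const (q (Suc i)) * (fps_const (Bc (Suc i)) * fps_X)"
      by (simp add: r_def H algebra_simps)
    also have "\<dots> = fps_const (q (Suc i)) + fps_const (e i) - fps_X - fps_const (e i) * y i"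
      unfolding 1 2 by (simp add: algebra_simps)
    also have "fps_const (e i) * y i = b i ^ 2 * s i"
      using q[of i] i by (simp add: b_sq s_def flip: mult.assoc)
    finally show ?thesis using i by (simp add: d_def)
  qed
  have s_deriv: "fps_deriv (s i) = - (s i ^ 2 * fps_deriv (r i))" if i: "1 \<le> i" "i \<le> N" for i
  proof -
    have "fps_deriv (r i * s i) = 0" using rs[OF i] by simp
    then have "s i * (r i * fps_deriv (s i) + fps_deriv (r i) * s i) = 0" by (simp add: algebra_simps)
    then have "r i * s i * fps_deriv (s i) + s i ^ 2 * fps_deriv (r i) = 0"
      by (simp add: algebra_simps power2_eq_square)
    then show ?thesis using rs[OF i] by (simp add: eq_neg_iff_add_eq_0)
  qed
  have r'_Suc: "fps_deriv (r (Suc i)) = - 1 + b i ^ 2 * s i ^ 2 * fps_deriv (r i)"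
    if i: "1 \<le> i" "i < N" for i
    using i s_deriv[of i] by (simp add: r_Suc b_sq d_def mult.assoc)
  have trace: "(\<Sum>i=1..N. ?R i i) = - (\<Sum>i=1..N. s i * fps_deriv (r i))"
  proof (rule trace_inverse_tridiagonal[where R = ?R and b = b and d = d and r = r and s = s
        and r' = "\<lambda>i. fps_deriv (r i)"])
    show "b (i - 1) * ?R (i - 1) j + d i * ?R i j + b i * ?R (Suc i) j = (if i = j then 1 else 0)"
      if "1 \<le> i" "i \<le> N" "1 \<le> j" "j \<le> N" for i j
      unfolding b_def d_def
      by (rule resolvent_fps_row) (use q e S that in \<open>auto intro: less_imp_le\<close>)
    show "fps_deriv (r 1) = - 1" unfolding r_first by (simp add: d_def)
    show "?R i j = ?R j i" for i j using resolvent_fps_sym S by blast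
    show "?R 0 j = 0" "?R (Suc N) j = 0" for j by (simp_all add: resolvent_fps_def)
  qed (fact r_first r_Suc rs r'_Suc)+
  \<comment> \<open>\<open>Gs_rec\<close> solves to \<open>x H' / (1 - H)\<close>; the constant
    \<open>q i\<close> cancels from the logarithmic derivative of \<open>r i\<close>.\<close>
  have Gs_eq: "Gs i = - (fps_X * (s i * fps_deriv (r i)))" if i: "1 \<le> i" "i \<le> N" for i
  proof -
    have "Gs i = y i * (Gs i * (1 - H i))"
      using y[of i] by (metis mult.assoc mult.commute mult_1)
    also have "Gs i * (1 - H i) = fps_X * fps_deriv (H i)"
      using Gs_rec[OF i] by (simp add: algebra_simps)
    finally have "Gs i = (fps_const (q i) * fps_const (1 / q i)) * (y i * (fps_X * fps_deriv (H i)))"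
      using const_q[OF i] by simp
    then show ?thesis by (simp only: r_def s_def) (simp add: algebra_simps)
  qed
  have "(\<Sum>i=1..N. Gs i) = (\<Sum>i=1..N. - (fps_X * (s i * fps_deriv (r i))))"
    by (rule sum.cong) (use Gs_eq in auto)
  also have "\<dots> = fps_X * (\<Sum>i=1..N. ?R i i)"
    unfolding trace by (simp add: sum_distrib_left sum_negf)
  finally have "fps_nth (\<Sum>i=1..N. Gs i) M = fps_nth (fps_X * (\<Sum>i=1..N. ?R i i)) M" by simp
  \<comment> \<open>As \<open>M \<ge> 1\<close>, the factor \<open>fps_X\<close> makes coefficient
    \<open>M\<close> equal to coefficient \<open>M - 1\<close> of the resolvent, which is an entry
    of \<open>S ^\<^sub>m M\<close>.\<close>
  then have "(\<Sum>i=1..N. G M i) = (\<Sum>i=1..N. (S ^\<^sub>m M) $$ (i - 1, i - 1))"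
    using M_pos by (simp add: fps_sum_nth Gs_def resolvent_fps_def del: pow_mat.simps(2))
  also have "\<dots> = (\<Sum>i<N. (S ^\<^sub>m M) $$ (i, i))"
    by (simp add: sum.atLeast1_atMost_eq)
  also have "\<dots> = J M ?B"
    using S by (simp add: J_def mat_trace_def)
  finally show ?thesis by simp
qed

end
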